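(* Let $p$ be an odd prime, $s\ge1$ and $k\ge1$ integers, and $0<\lambda<p^s$ an integer. Write $\lambda=p^r\lambda'$ with $0\le r<s$ and $p\nmid\lambda'$. Then $$\rho_{k,\lambda}(p^s)=\sum_{i=0}^{\lfloor r/2\rfloor}p^{ki+(s-2i-1)(k-1)}\cdot\rho^{(1)}_{k,\lambda/p^{2i}}(p).$$
   Context: For positive integers $k,n$ and an integer $\mu$, $\rho_{k,\mu}(n)$ is the number of $(x_1,\dots,x_k)\in(\mathbb{Z}/n\mathbb{Z})^k$ with $x_1^2+\cdots+x_k^2\equiv\mu\pmod n$. For a prime $p$, integers $t\ge1$ and $\mu$, $\rho^{(1)}_{k,\mu}(p^t)$ is the number of such solutions modulo $p^t$ (i.e. $(x_1,\dots,x_k)\in(\mathbb{Z}/p^t\mathbb{Z})^k$ with $x_1^2+\cdots+x_k^2\equiv\mu\pmod{p^t}$) for which $p\nmid x_i$ for at least one $i$. *)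

theory Defs
  imports "HOL-Number_Theory.Number_Theory"
begin

text \<open>
  The ring of integers modulo \<open>n\<close> (for \<open>n > 0\<close>) is represented by the least nonnegative
  residues \<open>{0..<int n}\<close>, and a \<open>k\<close>-tuple over it by an extensional function on \<open>{1..k}\<close>.
\<close>

definition sum_sq_sols :: "nat \<Rightarrow> int \<Rightarrow> nat \<Rightarrow> (nat \<Rightarrow> int) set" where
  "sum_sq_sols k \<mu> n =
     {x \<in> {1..k} \<rightarrow>\<^sub>E {0..<int n}. [(\<Sum>i = 1..k. (x i)\<^sup>2) = \<mu>] (mod int n)}"

definition rho :: "nat \<Rightarrow> int \<Rightarrow> nat \<Rightarrow> nat" where
  "rho k \<mu> n = card (sum_sq_sols k \<mu> n)"

text \<open>
  For \<open>t \<ge> 1\<close>, whether \<open>p\<close> divides a residue class modulo \<open>p ^ t\<close> does not depend on the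
  chosen representative.
\<close>

definition rho1 :: "nat \<Rightarrow> int \<Rightarrow> nat \<Rightarrow> nat \<Rightarrow> nat" where
  "rho1 k \<mu> p t =
     card {x \<in> sum_sq_sols k \<mu> (p ^ t). \<exists>i \<in> {1..k}. \<not> int p dvd x i}"

end

theory Submission
  imports Defs
begin

text \<open>
  A solution with some coordinate prime to \<open>p\<close> is a nonsingular point, so by Hensel each such
  solution modulo \<open>p ^ t\<close> lifts to exactly \<open>p ^ (k - 1)\<close> solutions modulo \<open>p ^ (t + 1)\<close>: the top
  digits of the lift satisfy one nondegenerate linear congruence modulo \<open>p\<close>. A solution \<open>p y\<close> with
  all coordinates divisible by \<open>p\<close> exists only if \<open>p\<^sup>2\<close> divides \<open>\<mu>\<close>; then \<open>y\<close>, known modulo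
  \<open>p ^ (s - 1)\<close>, solves the congruence for \<open>\<mu> / p\<^sup>2\<close> modulo \<open>p ^ (s - 2)\<close>, and its top digits are
  free. This gives a recursion in steps of two in \<open>r\<close> and \<open>s\<close>.
\<close>

section \<open>Splitting tuples of residues into lower and upper digits\<close>

lemma finite_PiE_int_interval: "finite I \<Longrightarrow> finite (I \<rightarrow>\<^sub>E {0..<M::int})"
  by (intro finite_PiE) auto

text \<open>Division with remainder by \<open>M\<close> in each coordinate: \<open>u\<close>
  collects the remainders and \<open>z\<close> the quotients, so the inverse is given by
  \<open>mod\<close> and \<open>div\<close>. The \<open>restrict\<close> keeps the recombined tuple
  extensional.\<close>

lemma digit_bij:
  fixes M N :: int and I :: "'a set"
  assumes "0 < M" and "0 < N"
  shows "bij_betw (\<lambda>(u, z). restrict (\<lambda>i. u i + M * z i) I)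
    ((I \<rightarrow>\<^sub>E {0..<M}) \<times> (I \<rightarrow>\<^sub>E {0..<N})) (I \<rightarrow>\<^sub>E {0..<M * N})"
proof (rule bij_betw_byWitness
    [where f' = "\<lambda>y. (restrict (\<lambda>i. y i mod M) I, restrict (\<lambda>i. y i div M) I)"], goal_cases)
  case 1
  show ?case
  proof (rule ballI)
    fix x assume "x \<in> (I \<rightarrow>\<^sub>E {0..<M}) \<times> (I \<rightarrow>\<^sub>E {0..<N})"
    then obtain u z where x: "x = (u, z)"
      and u: "u \<in> I \<rightarrow>\<^sub>E {0..<M}" and z: "z \<in> I \<rightarrow>\<^sub>E {0..<N}"
      by blast
    have "restrict (\<lambda>i. restrict (\<lambda>i. u i + M * z i) I i mod M) I i = u i" for i
      using PiE_mem[OF u, of i] PiE_arb[OF u, of i] by (cases "i \<in> I") auto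
    moreover have "restrict (\<lambda>i. restrict (\<lambda>i. u i + M * z i) I i div M) I i = z i" for i
      using PiE_mem[OF u, of i] PiE_arb[OF z, of i] assms by (cases "i \<in> I") auto
    ultimately show "(\<lambda>y. (restrict (\<lambda>i. y i mod M) I, restrict (\<lambda>i. y i div M) I))
        ((\<lambda>(u, z). restrict (\<lambda>i. u i + M * z i) I) x) = x"
      unfolding x case_prod_conv by blast
  qed
next
  case 2
  show ?case
  proof (rule ballI)
    fix y :: "'a \<Rightarrow> int"
    assume y: "y \<in> I \<rightarrow>\<^sub>E {0..<M * N}"
    have "restrict (\<lambda>i. restrict (\<lambda>i. y i mod M) I i + M * restrict (\<lambda>i. y i div M) I i) I i = y i" for i
      using PiE_arb[OF y, of i] by (cases "i \<in> I") auto
    then show "(\<lambda>(u, z). restrict (\<lambda>i. u i + M * z i) I)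
        (restrict (\<lambda>i. y i mod M) I, restrict (\<lambda>i. y i div M) I) = y"
      unfolding case_prod_conv by (rule ext)
  qed
next
  case 3
  have "a + M * b < M * N" if "0 \<le> a" "a < M" "b < N" for a b
  proof -
    \<comment> \<open>Over the integers \<open>b < N\<close> gives \<open>b + 1 \<le> N\<close>,
      which leaves room for a remainder below \<open>M\<close>.\<close>
    have "M * (b + 1) \<le> M * N"
      using that assms by (intro mult_left_mono) auto
    then show ?thesis using that by (simp add: algebra_simps)
  qed
  then show ?case using assms by (fastforce simp: PiE_iff)
next
  case 4
  have "b div M < N" if "0 \<le> b" "b < M * N" for b
  proof -
    have "M * (b div M) \<le> b"
      using assms pos_mod_sign[of M b] mult_div_mod_eq[of M b] by linarith
    then have "M * (b div M) < M * N" using that by simp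
    then show ?thesis using assms by simp
  qed
  then show ?case using assms by (auto simp: PiE_iff pos_imp_zdiv_nonneg_iff)
qed

text \<open>Counts by fibres of the reduction modulo \<open>M\<close>. With \<open>M\<close> a power
  of \<open>p\<close> and \<open>N = p\<close>, the inner cardinality is the number of admissible
  top digits above \<open>u\<close>.\<close>

lemma card_digit_split:
  fixes M N :: int
  assumes "finite I" and "0 < M" and "0 < N"
  shows "card {y \<in> I \<rightarrow>\<^sub>E {0..<M * N}. P y} =
    (\<Sum>u \<in> I \<rightarrow>\<^sub>E {0..<M}. card {z \<in> I \<rightarrow>\<^sub>E {0..<N}. P (restrict (\<lambda>i. u i + M * z i) I)})"
proof -
  let ?f = "\<lambda>(u, z). restrict (\<lambda>i. u i + M * z i) I"
  let ?S = "Sigma (I \<rightarrow>\<^sub>E {0..<M}) (\<lambda>u. {z \<in> I \<rightarrow>\<^sub>E {0..<N}. P (?f (u, z))})"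
  note bij = digit_bij[OF assms(2,3), of I]
  have "?f ` ?S = {y \<in> I \<rightarrow>\<^sub>E {0..<M * N}. P y}"
    unfolding bij_betw_imp_surj_on[OF bij, symmetric] by force
  moreover have "inj_on ?f ?S"
    by (rule inj_on_subset[OF bij_betw_imp_inj_on[OF bij]]) auto
  ultimately have "card {y \<in> I \<rightarrow>\<^sub>E {0..<M * N}. P y} = card ?S"
    by (metis (no_types, lifting) card_image)
  also have "\<dots> = (\<Sum>u \<in> I \<rightarrow>\<^sub>E {0..<M}. card {z \<in> I \<rightarrow>\<^sub>E {0..<N}. P (?f (u, z))})"
    using assms(1) by (intro card_SigmaI) (auto simp: finite_PiE_int_interval)
  finally show ?thesis by simp
qed

section \<open>Counting solutions of one linear congruence\<close>

text \<open>The unit coefficient \<open>a j\<close> lets the congruence be solved for coordinate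
  \<open>j\<close>, whatever the others are. Forgetting that coordinate is therefore a bijection
  onto all tuples over \<open>I - {j}\<close>.\<close>

lemma card_linear_cong_solutions:
  fixes a :: "'a \<Rightarrow> int" and n :: nat
  assumes "finite I" and "j \<in> I" and "coprime (a j) (int n)" and "n > 0"
  shows "card {z \<in> I \<rightarrow>\<^sub>E {0..<int n}. [(\<Sum>i\<in>I. a i * z i) = c] (mod int n)} = n ^ (card I - 1)"
proof -
  let ?J = "I - {j}"
  let ?S = "{z \<in> I \<rightarrow>\<^sub>E {0..<int n}. [(\<Sum>i\<in>I. a i * z i) = c] (mod int n)}"
  obtain b where b: "[a j * b = 1] (mod int n)"
    using assms(3) cong_solve_coprime_int by blast
  \<comment> \<open>The forced value of coordinate \<open>j\<close>, reduced to a digit. It reads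
    \<open>w\<close> only on \<open>I - {j}\<close>, so neither restricting \<open>w\<close> to that
    set nor updating it at \<open>j\<close> changes \<open>h w\<close>.\<close>
  define h where "h w = b * (c - (\<Sum>i\<in>?J. a i * w i)) mod int n" for w
  have sum_split: "(\<Sum>i\<in>I. a i * w i) = a j * w j + (\<Sum>i\<in>?J. a i * w i)" for w
    using assms(1,2) by (rule sum.remove)
  have h_solves: "[a j * h w + (\<Sum>i\<in>?J. a i * w i) = c] (mod int n)" for w
  proof -
    let ?d = "c - (\<Sum>i\<in>?J. a i * w i)"
    have "[a j * h w = a j * (b * ?d)] (mod int n)"
      unfolding h_def by (simp add: cong_def mod_mult_right_eq)
    also have "a j * (b * ?d) = a j * b * ?d" by simp
    also have "[\<dots> = 1 * ?d] (mod int n)"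
      by (intro cong_mult b cong_refl)
    finally show ?thesis
      by (simp add: cong_iff_dvd_diff algebra_simps)
  qed
  have h_unique: "z j = h z" if "z \<in> ?S" for z
  proof -
    have "[a j * z j + (\<Sum>i\<in>?J. a i * z i) = c] (mod int n)"
      using that sum_split[of z] by simp
    then have "[a j * z j + (\<Sum>i\<in>?J. a i * z i) = a j * h z + (\<Sum>i\<in>?J. a i * z i)] (mod int n)"
      using h_solves[of z] by (meson cong_trans cong_sym)
    then have "[z j = h z] (mod int n)"
      using assms(3) by (simp add: cong_add_rcancel cong_mult_lcancel)
    moreover have "z j \<in> {0..<int n}" using that assms(2) by auto
    ultimately show ?thesis
      by (simp add: cong_def h_def)
  qed
  have "bij_betw (\<lambda>z. restrict z ?J) ?S (?J \<rightarrow>\<^sub>E {0..<int n})"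
  proof (rule bij_betw_byWitness[where f' = "\<lambda>w. w(j := h w)"], goal_cases)
    case 1
    show ?case
    proof (intro ballI ext)
      fix z i assume z: "z \<in> ?S"
      have "h (restrict z ?J) = h z" by (simp add: h_def)
      then show "((restrict z ?J)(j := h (restrict z ?J))) i = z i"
        using h_unique[OF z] z by (auto simp: PiE_iff extensional_def)
    qed
  next
    case 2
    show ?case by (auto simp: PiE_iff extensional_def fun_eq_iff)
  next
    case 3
    show ?case by (intro image_subsetI, unfold restrict_PiE_iff) auto
  next
    case 4
    show ?case
    proof (intro image_subsetI CollectI conjI)
      fix w assume w: "w \<in> ?J \<rightarrow>\<^sub>E {0..<int n}"
      have "h w \<in> {0..<int n}" using assms(4) by (simp add: h_def)
      then show "w(j := h w) \<in> I \<rightarrow>\<^sub>E {0..<int n}"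
        using w assms(2) by (auto simp: PiE_iff extensional_def)
      have "(\<Sum>i\<in>?J. a i * (w(j := h w)) i) = (\<Sum>i\<in>?J. a i * w i)"
        by (intro sum.cong) auto
      then show "[(\<Sum>i\<in>I. a i * (w(j := h w)) i) = c] (mod int n)"
        using h_solves[of w] sum_split[of "w(j := h w)"] by simp
    qed
  qed
  then have "card ?S = card (?J \<rightarrow>\<^sub>E {0..<int n})" by (rule bij_betw_same_card)
  also have "\<dots> = n ^ (card I - 1)"
    using assms(1,2) by (simp add: card_PiE)
  finally show ?thesis .
qed

section \<open>Hensel lifting of primitive solutions\<close>

lemma sum_sq_lift:
  fixes u z :: "'a \<Rightarrow> int"
  shows "(\<Sum>i\<in>I. (u i + m * z i)\<^sup>2) =
    (\<Sum>i\<in>I. (u i)\<^sup>2) + m * (\<Sum>i\<in>I. 2 * u i * z i) + m\<^sup>2 * (\<Sum>i\<in>I. (z i)\<^sup>2)"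
  by (simp add: sum.distrib sum_distrib_left power2_eq_square algebra_simps)

lemma sum_sq_lift_cong:
  fixes u z :: "'a \<Rightarrow> int"
  shows "[(\<Sum>i\<in>I. (u i + m * z i)\<^sup>2) = (\<Sum>i\<in>I. (u i)\<^sup>2)] (mod m)"
  unfolding sum_sq_lift by (simp add: cong_iff_dvd_diff power2_eq_square mult.assoc)

text \<open>Expanding the squares and dividing by \<open>p ^ t\<close> turns the condition on the
  top digits \<open>z\<close> into a linear congruence modulo \<open>p\<close> with coefficients
  \<open>2 * u i\<close>. Since \<open>p\<close> is odd, the coefficient at \<open>j\<close> is a
  unit.\<close>

lemma card_sum_sq_lifts:
  fixes u :: "nat \<Rightarrow> int"
  assumes p: "prime p" "odd p" and t: "t \<ge> 1"
    and u: "[(\<Sum>i = 1..k. (u i)\<^sup>2) = \<mu>] (mod int p ^ t)"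
    and j: "j \<in> {1..k}" "\<not> int p dvd u j"
  shows "card {z \<in> {1..k} \<rightarrow>\<^sub>E {0..<int p}.
      [(\<Sum>i = 1..k. (u i + int p ^ t * z i)\<^sup>2) = \<mu>] (mod int p ^ Suc t)} = p ^ (k - 1)"
proof -
  let ?I = "{1..k}" and ?q = "int p ^ t"
  have p0: "0 < p" using p by (simp add: prime_gt_0_nat)
  \<comment> \<open>The defect of \<open>u\<close>, divided by \<open>p ^ t\<close>, becomes the
    right-hand side of the linear congruence.\<close>
  obtain e where e: "\<mu> - (\<Sum>i\<in>?I. (u i)\<^sup>2) = ?q * e"
    using u by (meson cong_iff_dvd_diff cong_sym dvd_def)
  have "[(\<Sum>i\<in>?I. (u i + ?q * z i)\<^sup>2) = \<mu>] (mod int p ^ Suc t) \<longleftrightarrow>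
      [(\<Sum>i\<in>?I. 2 * u i * z i) = e] (mod int p)" for z
  proof -
    let ?L = "\<Sum>i\<in>?I. 2 * u i * z i" and ?Z = "\<Sum>i\<in>?I. (z i)\<^sup>2"
    \<comment> \<open>Because \<open>t \<ge> 1\<close>, the quadratic term of the expansion is still
      divisible by \<open>p\<close> after division by \<open>p ^ t\<close>, so it drops out.\<close>
    have dvd: "int p dvd ?q * ?Z" using t by (simp add: dvd_power)
    have "(\<Sum>i\<in>?I. (u i + ?q * z i)\<^sup>2) - \<mu> = ?q * (?L - e + ?q * ?Z)"
      unfolding sum_sq_lift using e by (simp add: algebra_simps power2_eq_square)
    then have "[(\<Sum>i\<in>?I. (u i + ?q * z i)\<^sup>2) = \<mu>] (mod int p ^ Suc t) \<longleftrightarrow>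
        ?q * int p dvd ?q * (?L - e + ?q * ?Z)"
      by (simp add: cong_iff_dvd_diff mult.commute)
    also have "\<dots> \<longleftrightarrow> int p dvd ?L - e"
      using p0 dvd by (simp add: dvd_add_left_iff)
    finally show ?thesis by (simp add: cong_iff_dvd_diff)
  qed
  moreover have "coprime (2 * u j) (int p)"
  proof -
    have "coprime (int p) (u j)"
      using p j by (simp add: prime_imp_coprime)
    moreover have "coprime (int p) 2"
      using p by simp
    ultimately show ?thesis
      by (simp add: coprime_commute)
  qed
  ultimately show ?thesis
    using card_linear_cong_solutions[of ?I j "\<lambda>i. 2 * u i" p e] p j
    by (simp add: prime_gt_0_nat)
qed

lemma rho1_Suc:
  assumes p: "prime p" "odd p" and t: "t \<ge> 1"
  shows "rho1 k \<mu> p (Suc t) = p ^ (k - 1) * rho1 k \<mu> p t"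
proof -
  let ?I = "{1..k}" and ?q = "int p ^ t"
  let ?P = "\<lambda>n y. [(\<Sum>i = 1..k. (y i)\<^sup>2) = \<mu>] (mod int p ^ n) \<and> (\<exists>i\<in>?I. \<not> int p dvd y i)"
  have rho1_eq: "rho1 k \<mu> p n = card {y \<in> ?I \<rightarrow>\<^sub>E {0..<int p ^ n}. ?P n y}" for n
    by (auto simp: rho1_def sum_sq_sols_def intro!: arg_cong[where f = card])
  have p0: "0 < int p" using p by (simp add: prime_gt_0_nat)
  have q: "int p dvd ?q" using t by (simp add: dvd_power)
  have fiber: "card {z \<in> ?I \<rightarrow>\<^sub>E {0..<int p}. ?P (Suc t) (restrict (\<lambda>i. u i + ?q * z i) ?I)} =
      (if ?P t u then p ^ (k - 1) else 0)" for u
  proof -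
    \<comment> \<open>As \<open>p\<close> divides \<open>p ^ t\<close>, the top digits do not affect
      which coordinates are divisible by \<open>p\<close>.\<close>
    have prim: "(\<exists>i\<in>?I. \<not> int p dvd u i + ?q * z i) \<longleftrightarrow> (\<exists>i\<in>?I. \<not> int p dvd u i)" for z
      using q by (simp add: dvd_add_left_iff)
    show ?thesis
    proof (cases "?P t u")
      case True
      then obtain j where "j \<in> ?I" "\<not> int p dvd u j" by blast
      with True card_sum_sq_lifts[OF p t, where u = u and j = j] prim show ?thesis by simp
    next
      case False
      \<comment> \<open>A primitive solution modulo \<open>p ^ Suc t\<close> reduces to a primitive
        solution modulo \<open>p ^ t\<close>, so the fibre over any other \<open>u\<close> is
        empty.\<close>
      have "\<not> ?P (Suc t) (restrict (\<lambda>i. u i + ?q * z i) ?I)" for z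
      proof
        assume *: "?P (Suc t) (restrict (\<lambda>i. u i + ?q * z i) ?I)"
        then have "[(\<Sum>i\<in>?I. (u i + ?q * z i)\<^sup>2) = \<mu>] (mod int p ^ Suc t)" by simp
        then have "[(\<Sum>i\<in>?I. (u i + ?q * z i)\<^sup>2) = \<mu>] (mod ?q)"
          by (rule cong_dvd_modulus) simp
        then have "[(\<Sum>i\<in>?I. (u i)\<^sup>2) = \<mu>] (mod ?q)"
          using sum_sq_lift_cong cong_sym cong_trans by blast
        moreover have "\<exists>i\<in>?I. \<not> int p dvd u i" using * prim[of z] by simp
        ultimately show False using False by blast
      qed
      then have "{z \<in> ?I \<rightarrow>\<^sub>E {0..<int p}. ?P (Suc t) (restrict (\<lambda>i. u i + ?q * z i) ?I)} = {}"
        by blast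
      then show ?thesis by (simp only: False if_False card.empty)
    qed
  qed
  have "rho1 k \<mu> p (Suc t) = card {y \<in> ?I \<rightarrow>\<^sub>E {0..<?q * int p}. ?P (Suc t) y}"
    unfolding rho1_eq by (simp only: power_Suc2)
  also have "\<dots> = (\<Sum>u \<in> ?I \<rightarrow>\<^sub>E {0..<?q}. if ?P t u then p ^ (k - 1) else 0)"
    using p0 by (subst card_digit_split) (simp_all only: fiber, auto)
  also have "\<dots> = p ^ (k - 1) * rho1 k \<mu> p t"
    unfolding rho1_eq by (simp add: finite_PiE_int_interval flip: sum.inter_filter)
  finally show ?thesis .
qed

lemma rho1_eq_rho1_prime:
  assumes "prime p" "odd p"
  shows "rho1 k \<mu> p (Suc t) = p ^ (t * (k - 1)) * rho1 k \<mu> p 1"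
  by (induction t) (simp_all add: rho1_Suc[OF assms] power_add)

section \<open>Primitive and imprimitive solutions\<close>

lemma rho_split:
  "rho k \<mu> (p ^ s) = rho1 k \<mu> p s + card {x \<in> sum_sq_sols k \<mu> (p ^ s). \<forall>i\<in>{1..k}. int p dvd x i}"
proof -
  have "finite (sum_sq_sols k \<mu> (p ^ s))"
    unfolding sum_sq_sols_def by (simp add: finite_PiE_int_interval)
  then show ?thesis
    unfolding rho_def rho1_def
    by (subst card_Un_disjoint[symmetric]) (auto intro!: arg_cong[where f = card])
qed

text \<open>If \<open>p\<close> divides every coordinate, then \<open>p\<^sup>2\<close> divides the
  sum of squares. For \<open>s \<ge> 2\<close> this forces \<open>p\<^sup>2\<close> to divide
  \<open>\<mu>\<close>. For \<open>s = 1\<close> the congruence only shows that \<open>p\<close>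
  divides \<open>\<mu>\<close>, hence the separate assumption.\<close>

lemma rho_primitive:
  assumes s: "s \<ge> 1" and \<mu>: "\<not> (int p)\<^sup>2 dvd \<mu>" "s = 1 \<Longrightarrow> \<not> int p dvd \<mu>"
  shows "rho k \<mu> (p ^ s) = rho1 k \<mu> p s"
proof -
  have False if x: "x \<in> sum_sq_sols k \<mu> (p ^ s)" "\<forall>i\<in>{1..k}. int p dvd x i" for x
  proof -
    have dvd: "(int p)\<^sup>2 dvd (\<Sum>i = 1..k. (x i)\<^sup>2)"
      using x(2) by (intro dvd_sum) (simp add: dvd_power_same)
    have cong: "[(\<Sum>i = 1..k. (x i)\<^sup>2) = \<mu>] (mod int p ^ s)"
      using x(1) by (simp add: sum_sq_sols_def)
    show False
    proof (cases "s = 1")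
      case True
      have "int p dvd (\<Sum>i = 1..k. (x i)\<^sup>2)"
        using dvd by (rule dvd_trans[rotated]) simp
      then show False using cong True \<mu>(2) by (simp add: cong_dvd_iff)
    next
      case False
      have "(int p)\<^sup>2 dvd int p ^ s" using False s by (intro le_imp_power_dvd) simp
      then have "[(\<Sum>i = 1..k. (x i)\<^sup>2) = \<mu>] (mod (int p)\<^sup>2)"
        using cong cong_dvd_modulus by blast
      then show False using dvd \<mu>(1) by (simp add: cong_dvd_iff)
    qed
  qed
  then have "{x \<in> sum_sq_sols k \<mu> (p ^ s). \<forall>i\<in>{1..k}. int p dvd x i} = {}" by blast
  then show ?thesis unfolding rho_split by (simp only: card.empty)
qed

text \<open>Writing \<open>x = p y\<close> removes one factor \<open>p\<close> from the range of the
  coordinates but two from the modulus. So \<open>y\<close> runs below \<open>p ^ (s + 1)\<close>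
  while the congruence sees it only modulo \<open>p ^ s\<close>; the \<open>k\<close> free top
  digits give the factor \<open>p ^ k\<close>.\<close>

lemma card_imprimitive:
  assumes p: "prime p"
  shows "card {x \<in> sum_sq_sols k ((int p)\<^sup>2 * \<nu>) (p ^ (s + 2)). \<forall>i\<in>{1..k}. int p dvd x i} =
    p ^ k * rho k \<nu> (p ^ s)"
proof -
  let ?I = "{1..k}" and ?q = "int p ^ s"
  let ?Q = "\<lambda>y. [(\<Sum>i = 1..k. (y i)\<^sup>2) = \<nu>] (mod ?q)"
  let ?T = "{y \<in> ?I \<rightarrow>\<^sub>E {0..<?q * int p}. ?Q y}"
  let ?g = "\<lambda>y. restrict (\<lambda>i. int p * y i) ?I"
  have p0: "0 < int p" using p by (simp add: prime_gt_0_nat)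
  have scale: "[(\<Sum>i = 1..k. (int p * y i)\<^sup>2) = (int p)\<^sup>2 * \<nu>] (mod int p ^ (s + 2)) \<longleftrightarrow> ?Q y" for y
  proof -
    have "(\<Sum>i = 1..k. (int p * y i)\<^sup>2) - (int p)\<^sup>2 * \<nu> = (int p)\<^sup>2 * ((\<Sum>i = 1..k. (y i)\<^sup>2) - \<nu>)"
      by (simp add: power_mult_distrib sum_distrib_left right_diff_distrib)
    moreover have "int p ^ (s + 2) = (int p)\<^sup>2 * ?q" by (simp add: power2_eq_square)
    ultimately show ?thesis using p0 by (simp only: cong_iff_dvd_diff dvd_mult_cancel_left) simp
  qed
  have bound: "int p * a < int p ^ (s + 2) \<longleftrightarrow> a < ?q * int p" for a
    using p0 by (simp add: power_add power2_eq_square mult.commute mult.left_commute)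
  have "bij_betw ?g ?T {x \<in> sum_sq_sols k ((int p)\<^sup>2 * \<nu>) (p ^ (s + 2)). \<forall>i\<in>?I. int p dvd x i}"
  proof (rule bij_betw_byWitness[where f' = "\<lambda>x. restrict (\<lambda>i. x i div int p) ?I"], goal_cases)
    case 1
    show ?case using p0 by (auto simp: PiE_iff extensional_def fun_eq_iff)
  next
    case 2
    show ?case by (auto simp: sum_sq_sols_def PiE_iff extensional_def fun_eq_iff)
  next
    case 3
    show ?case
    proof (intro image_subsetI)
      fix y assume y: "y \<in> ?T"
      have "?g y \<in> ?I \<rightarrow>\<^sub>E {0..<int p ^ (s + 2)}"
        using y p0 bound by (auto simp: PiE_iff simp del: power_Suc)
      then show "?g y \<in> {x \<in> sum_sq_sols k ((int p)\<^sup>2 * \<nu>) (p ^ (s + 2)). \<forall>i\<in>?I. int p dvd x i}"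
        using y scale[of y] by (simp add: sum_sq_sols_def)
    qed
  next
    case 4
    show ?case
    proof (intro image_subsetI)
      fix x assume x: "x \<in> {x \<in> sum_sq_sols k ((int p)\<^sup>2 * \<nu>) (p ^ (s + 2)). \<forall>i\<in>?I. int p dvd x i}"
      let ?y = "restrict (\<lambda>i. x i div int p) ?I"
      have xy: "x i = int p * ?y i" if "i \<in> ?I" for i using x that by auto
      have xr: "0 \<le> x i" "x i < int p ^ (s + 2)" if "i \<in> ?I" for i
        using x that by (auto simp: sum_sq_sols_def PiE_iff)
      have "?y i \<in> {0..<?q * int p}" if "i \<in> ?I" for i
        using xr[OF that] bound[of "?y i"] p0 unfolding xy[OF that, symmetric]
        using that by (auto simp: pos_imp_zdiv_nonneg_iff)
      then have mem: "?y \<in> ?I \<rightarrow>\<^sub>E {0..<?q * int p}" by (auto simp: PiE_iff)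
      have "(\<Sum>i = 1..k. (x i)\<^sup>2) = (\<Sum>i = 1..k. (int p * ?y i)\<^sup>2)"
        using xy by (intro sum.cong) auto
      moreover have "[(\<Sum>i = 1..k. (x i)\<^sup>2) = (int p)\<^sup>2 * \<nu>] (mod int p ^ (s + 2))"
        using x by (simp add: sum_sq_sols_def)
      ultimately have "?Q ?y" by (simp only: scale)
      with mem show "?y \<in> ?T" by blast
    qed
  qed
  then have "card {x \<in> sum_sq_sols k ((int p)\<^sup>2 * \<nu>) (p ^ (s + 2)). \<forall>i\<in>?I. int p dvd x i} = card ?T"
    by (simp add: bij_betw_same_card)
  also have "\<dots> = (\<Sum>u \<in> ?I \<rightarrow>\<^sub>E {0..<?q}. card {z \<in> ?I \<rightarrow>\<^sub>E {0..<int p}.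
      ?Q (restrict (\<lambda>i. u i + ?q * z i) ?I)})"
    using p0 by (intro card_digit_split) auto
  also have "\<dots> = (\<Sum>u \<in> ?I \<rightarrow>\<^sub>E {0..<?q}. if ?Q u then p ^ k else 0)"
  proof (intro sum.cong refl)
    fix u :: "nat \<Rightarrow> int"
    \<comment> \<open>The congruence depends on the lower digits \<open>u\<close> alone, so above
      each \<open>u\<close> either all \<open>p ^ k\<close> choices of \<open>z\<close> count or
      none does.\<close>
    have "?Q (restrict (\<lambda>i. u i + ?q * z i) ?I) \<longleftrightarrow> ?Q u" for z
      using sum_sq_lift_cong[where u = u and m = ?q and z = z and I = ?I] by (simp add: cong_def)
    then show "card {z \<in> ?I \<rightarrow>\<^sub>E {0..<int p}. ?Q (restrict (\<lambda>i. u i + ?q * z i) ?I)} =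
        (if ?Q u then p ^ k else 0)"
      by (simp add: card_PiE)
  qed
  also have "\<dots> = p ^ k * rho k \<nu> (p ^ s)"
    by (simp add: finite_PiE_int_interval rho_def sum_sq_sols_def flip: sum.inter_filter)
  finally show ?thesis .
qed

section \<open>The recursion in the exponent of \<open>p\<close>\<close>

text \<open>Induction on \<open>r\<close> in steps of two, with \<open>s\<close> arbitrary because
  it drops along with \<open>r\<close>. For \<open>r < 2\<close> every solution is primitive and
  only the summand \<open>i = 0\<close> occurs. Throughout the sum \<open>2 * i \<le> r < s\<close>,
  so the subtraction in \<open>s - 2 * i - 1\<close> is never truncated.\<close>

lemma rho_prime_power:
  fixes p s k r :: nat and m :: int
  assumes p: "prime p" "odd p" and m: "\<not> int p dvd m"
  shows "r < s \<Longrightarrow> rho k (int p ^ r * m) (p ^ s) =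
    (\<Sum>i = 0..r div 2. p ^ (k * i + (s - 2 * i - 1) * (k - 1)) *
       rho1 k (int p ^ r * m div int p ^ (2 * i)) p 1)"
proof (induction r arbitrary: s rule: less_induct)
  case (less r)
  have p0: "int p \<noteq> 0" using p by (simp add: prime_gt_0_nat)
  have prim: "rho1 k \<mu> p s = p ^ ((s - 1) * (k - 1)) * rho1 k \<mu> p 1" for \<mu>
    using rho1_eq_rho1_prime[OF p, of k \<mu> "s - 1"] less.prems by simp
  show ?case
  proof (cases "r < 2")
    case True
    have "\<not> (int p)\<^sup>2 dvd int p ^ r * m"
    proof
      assume "(int p)\<^sup>2 dvd int p ^ r * m"
      moreover have "int p ^ Suc r dvd (int p)\<^sup>2" using True by (intro le_imp_power_dvd) simp
      ultimately have "int p ^ r * int p dvd int p ^ r * m"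
        by (metis dvd_trans power_Suc2)
      then show False using p0 m by simp
    qed
    \<comment> \<open>Here \<open>s = 1\<close> forces \<open>r = 0\<close>, so the number is
      \<open>m\<close> itself.\<close>
    moreover have "\<not> int p dvd int p ^ r * m" if "s = 1" using that less.prems m by simp
    ultimately have "rho k (int p ^ r * m) (p ^ s) = rho1 k (int p ^ r * m) p s"
      using less.prems by (intro rho_primitive) auto
    then show ?thesis using True by (simp add: prim)
  next
    case False
    define r' s' where "r' = r - 2" and "s' = s - 2"
    have r: "r = r' + 2" and s: "s = s' + 2" and r's': "r' < s'"
      using False less.prems by (auto simp: r'_def s'_def)
    let ?\<mu> = "int p ^ r * m" and ?\<nu> = "int p ^ r' * m"
    let ?F = "\<lambda>i. p ^ (k * i + (s - 2 * i - 1) * (k - 1)) * rho1 k (?\<mu> div int p ^ (2 * i)) p 1"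
    have \<mu>: "?\<mu> = (int p)\<^sup>2 * ?\<nu>" by (simp add: r power2_eq_square)
    \<comment> \<open>The summand \<open>i + 1\<close> for \<open>(r, s)\<close> is
      \<open>p ^ k\<close> times the summand \<open>i\<close> for \<open>(r', s')\<close>: one extra
      \<open>k\<close> in the exponent, and both \<open>s\<close> and \<open>2 * i\<close> shift by
      two.\<close>
    have shift: "?F (Suc i) = p ^ k * (p ^ (k * i + (s' - 2 * i - 1) * (k - 1)) *
        rho1 k (?\<nu> div int p ^ (2 * i)) p 1)" for i
    proof -
      have "int p ^ (2 * Suc i) = (int p)\<^sup>2 * int p ^ (2 * i)" by (simp add: power_add power2_eq_square)
      then have "?\<mu> div int p ^ (2 * Suc i) = (int p)\<^sup>2 * ?\<nu> div ((int p)\<^sup>2 * int p ^ (2 * i))"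
        by (simp only: \<mu>)
      also have "\<dots> = ?\<nu> div int p ^ (2 * i)"
        using p0 by (intro div_mult_mult1) simp
      finally have "?\<mu> div int p ^ (2 * Suc i) = ?\<nu> div int p ^ (2 * i)" .
      moreover have "s - 2 * Suc i - 1 = s' - 2 * i - 1" by (simp add: s)
      ultimately show ?thesis by (simp only: power_add mult_Suc_right mult.assoc)
    qed
    have "rho k ?\<mu> (p ^ s) = rho1 k ?\<mu> p s + p ^ k * rho k ?\<nu> (p ^ s')"
      unfolding rho_split[of k ?\<mu> p s] using card_imprimitive[OF p(1), of k ?\<nu> s']
      unfolding \<mu> s by simp
    \<comment> \<open>The primitive solutions supply the first summand; the imprimitive ones supply
      all the others through the induction hypothesis.\<close>
    also have "rho1 k ?\<mu> p s = ?F 0" by (simp add: prim)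
    also have "p ^ k * rho k ?\<nu> (p ^ s') = (\<Sum>i = 0..r' div 2. ?F (Suc i))"
      unfolding shift using less.IH[of r' s'] r r's' by (simp add: sum_distrib_left)
    also have "?F 0 + \<dots> = (\<Sum>i = 0..Suc (r' div 2). ?F i)"
      by (rule sum.atLeast0_atMost_Suc_shift[symmetric, unfolded comp_def])
    also have "Suc (r' div 2) = r div 2" by (simp add: r)
    finally show ?thesis .
  qed
qed

theorem theorem1:
  fixes p s k r :: nat and l l' :: int
  assumes "prime p" and "odd p"
    and "s \<ge> 1" and "k \<ge> 1"
    and "0 < l" and "l < int p ^ s"
    and "l = int p ^ r * l'" and "r < s" and "\<not> int p dvd l'"
  shows "rho k l (p ^ s) =
    (\<Sum>i = 0..r div 2.
       p ^ (k * i + (s - 2 * i - 1) * (k - 1)) * rho1 k (l div int p ^ (2 * i)) p 1)"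
  using rho_prime_power[OF assms(1,2,9,8)] assms(7) by simp

end
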